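(* Let $F\subset\mathbb{C}$ be a field and let $\Gamma$ be a finitely generated subgroup of $F^*$ with $-1\in\Gamma$. Let $R$ be a subring of $F$ which is generated as a $\mathbb{Z}$-module by a finite set $\mathcal{E}\subset\Gamma\cap R$. Let $n\geq I\geq 2$ be integers and assume that the equation $$u_1+\dots+u_I=n,\qquad u_1,\dots,u_I\in\Gamma\cap R$$ has a solution $(u_1,\dots,u_I)\neq(1,\dots,1)$. Then $\omega_\Gamma(R)\leq n-1$; that is, every nonzero $\alpha\in R$ can be written as $\alpha=a_1\nu_1+\dots+a_\ell\nu_\ell$ with pairwise distinct $\nu_1,\dots,\nu_\ell\in\Gamma\cap R$ and integers $a_1,\dots,a_\ell\in\{1,\dots,n-1\}$.
   Context: Let $F$ be a field of characteristic $0$, $\Gamma$ a finitely generated subgroup of $F^*$ and $R\subset F$ a subring. For $\alpha\in R$, if $\alpha$ can be written as $\alpha=a_1\nu_1+\dots+a_\ell\nu_\ell$ with pairwise distinct $\nu_1,\dots,\nu_\ell\in\Gamma\cap R$ and integers $a_1\geq\dots\geq a_\ell>0$, the $R$-$\Gamma$-unit sum height $\omega_{R,\Gamma}(\alpha)$ is the smallest possible value of $a_1$ over all such representations; $\omega_{R,\Gamma}(0)=0$, and $\omega_{R,\Gamma}(\alpha)=\infty$ if no such representation exists. Then $\omega_\Gamma(R)=\max\{\omega_{R,\Gamma}(\alpha):\alpha\in R\}$ if this maximum exists; otherwise $\omega_\Gamma(R)=\omega$ if all $\omega_{R,\Gamma}(\alpha)<\infty$, and $\omega_\Gamma(R)=\infty$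 if some $\omega_{R,\Gamma}(\alpha)=\infty$. *)

theory Defs
  imports Complex_Main "HOL-Library.Extended_Nat"
begin

definition subfield_C :: "complex set \<Rightarrow> bool" where
  "subfield_C F \<longleftrightarrow> 0 \<in> F \<and> 1 \<in> F \<and>
     (\<forall>x\<in>F. \<forall>y\<in>F. x + y \<in> F \<and> x * y \<in> F) \<and>
     (\<forall>x\<in>F. - x \<in> F) \<and> (\<forall>x\<in>F. x \<noteq> 0 \<longrightarrow> inverse x \<in> F)"

definition mult_subgroup :: "'a::field set \<Rightarrow> 'a set \<Rightarrow> bool" where
  "mult_subgroup F H \<longleftrightarrow> H \<subseteq> F - {0} \<and> 1 \<in> H \<and>
     (\<forall>x\<in>H. \<forall>y\<in>H. x * y \<in> H) \<and> (\<forall>x\<in>H. inverse x \<in> H)"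

definition fin_gen_mult_subgroup :: "'a::field set \<Rightarrow> 'a set \<Rightarrow> bool" where
  "fin_gen_mult_subgroup F \<Gamma> \<longleftrightarrow> mult_subgroup F \<Gamma> \<and>
     (\<exists>S. finite S \<and> \<Gamma> = \<Inter>{H. mult_subgroup F H \<and> S \<subseteq> H})"

definition subring_of :: "'a::comm_ring_1 set \<Rightarrow> 'a set \<Rightarrow> bool" where
  "subring_of F R \<longleftrightarrow> R \<subseteq> F \<and> 0 \<in> R \<and> 1 \<in> R \<and>
     (\<forall>x\<in>R. \<forall>y\<in>R. x + y \<in> R \<and> x * y \<in> R) \<and> (\<forall>x\<in>R. - x \<in> R)"

definition int_span :: "'a::comm_ring_1 set \<Rightarrow> 'a set" where
  "int_span E = {\<Sum>e\<in>E. of_int (c e) * e | c. True}"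

definition rep_heights :: "'a::comm_ring_1 set \<Rightarrow> 'a set \<Rightarrow> 'a \<Rightarrow> nat set" where
  "rep_heights R \<Gamma> \<alpha> = {Max (a ` N) | N a. finite N \<and> N \<noteq> {} \<and> N \<subseteq> \<Gamma> \<inter> R \<and>
       (\<forall>\<nu>\<in>N. a \<nu> > 0) \<and> \<alpha> = (\<Sum>\<nu>\<in>N. of_nat (a \<nu>) * \<nu>)}"

text \<open>R-Gamma-unit sum height of alpha (infinity if no representation).\<close>
definition ush_height :: "'a::comm_ring_1 set \<Rightarrow> 'a set \<Rightarrow> 'a \<Rightarrow> enat" where
  "ush_height R \<Gamma> \<alpha> = (if \<alpha> = 0 then 0 else Inf (enat ` rep_heights R \<Gamma> \<alpha>))"

datatype ush_value = Fin nat | Omega | Infinity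

definition ush_ring :: "'a::comm_ring_1 set \<Rightarrow> 'a set \<Rightarrow> ush_value" where
  "ush_ring \<Gamma> R =
     (if \<exists>m. (\<exists>\<alpha>\<in>R. ush_height R \<Gamma> \<alpha> = enat m) \<and> (\<forall>\<alpha>\<in>R. ush_height R \<Gamma> \<alpha> \<le> enat m)
      then Fin (THE m. (\<exists>\<alpha>\<in>R. ush_height R \<Gamma> \<alpha> = enat m) \<and> (\<forall>\<alpha>\<in>R. ush_height R \<Gamma> \<alpha> \<le> enat m))
      else if \<forall>\<alpha>\<in>R. ush_height R \<Gamma> \<alpha> < \<infinity> then Omega else Infinity)"

end

theory Submission
  imports Defs "HOL-Library.Multiset" "HOL-Library.FuncSet"
begin

text \<open>For I < n, replace n copies of \<nu> by the terms u_i \<nu>: this shortens a representation, so one with the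
  fewest terms has multiplicities below n. For I = n the replacement is a chip-firing move that
  preserves the number of terms and strictly increases the sum of the squared absolute values,
  and it must be shown that it cannot go on forever. A representation with the fewest terms has no
  vanishing subsum, and neither has any configuration reachable from it. By induction on the number N of
  chips, firing terminates for such configurations: a configuration that splits into far apart
  clusters terminates because the clusters do, so the nonterminating ones fall into finitely many
  classes up to scaling. An infinite run would meet a class twice; the invariant nonzero sum forces
  the two configurations to be equal, contradicting the growth of the squares.\<close>

section \<open>Scaling and energy of multisets of complex numbers\<close>

definition scale :: "complex \<Rightarrow> complex multiset \<Rightarrow> complex multiset" where
  "scale c M = image_mset ((*) c) M"

lemma scale_add [simp]: "scale c (A + B) = scale c A + scale c B"
  by (simp add: scale_def)

lemma scale_scale [simp]: "scale c (scale d M) = scale (c * d) M"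
  by (induction M) (simp_all add: scale_def mult.assoc)

lemma scale_1 [simp]: "scale 1 M = M"
  by (induction M) (simp_all add: scale_def)

lemma scale_replicate [simp]: "scale c (replicate_mset k v) = replicate_mset k (c * v)"
  by (simp add: scale_def)

lemma size_scale [simp]: "size (scale c M) = size M"
  by (simp add: scale_def)

lemma scale_empty_iff [simp]: "scale c M = {#} \<longleftrightarrow> M = {#}"
  by (simp add: scale_def)

lemma sum_mset_scale [simp]: "sum_mset (scale c M) = c * sum_mset M"
  by (induction M) (simp_all add: scale_def algebra_simps)

lemma set_mset_scale [simp]: "set_mset (scale c M) = (*) c ` set_mset M"
  by (simp add: scale_def)

lemma scale_subseteq: "A \<subseteq># B \<Longrightarrow> scale c A \<subseteq># scale c B"
  by (simp add: scale_def image_mset_subseteq_mono)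

definition energy :: "complex multiset \<Rightarrow> real" where
  "energy M = (\<Sum>x\<in>#M. (cmod x)\<^sup>2)"

lemma energy_add [simp]: "energy (A + B) = energy A + energy B"
  by (simp add: energy_def)

lemma energy_scale [simp]: "energy (scale c M) = (cmod c)\<^sup>2 * energy M"
  by (induction M) (simp_all add: energy_def scale_def norm_mult power_mult_distrib algebra_simps)

lemma energy_replicate [simp]: "energy (replicate_mset k v) = real k * (cmod v)\<^sup>2"
  by (simp add: energy_def)

text \<open>Lets an arbitrary multiset be viewed as a sum of one-chip clusters.\<close>

lemma mset_eq_sum_singletons: "mset xs = (\<Sum>j<length xs. {#xs ! j#})"
proof (induction xs rule: rev_induct)
  case (snoc x xs)
  have "(\<Sum>j<length xs. {#(xs @ [x]) ! j#}) = (\<Sum>j<length xs. {#xs ! j#})"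
    by (intro sum.cong) (auto simp: nth_append)
  then show ?case using snoc by simp
qed simp

text \<open>Summing |x - 1|^2 = |x|^2 - 2 Re x + 1 over \<open>U\<close> gives
  \<open>energy U - size U\<close>, since the elements of \<open>U\<close> add up to
  \<open>size U\<close>; an element other than 1 makes this sum positive.\<close>

lemma energy_gt_size:
  assumes "sum_mset U = of_nat (size U)" and "\<exists>u\<in>#U. u \<noteq> 1"
  shows "real (size U) < energy U"
proof -
  have expand: "(\<Sum>x\<in>#M. (cmod (x - 1))\<^sup>2) = energy M - 2 * Re (sum_mset M) + real (size M)" for M
    by (induction M) (simp_all add: energy_def cmod_power2 power2_eq_square[of "Re _"] power2_eq_square[of "Re _ - 1"] algebra_simps)
  have nonneg: "0 \<le> (\<Sum>x\<in>#M. (cmod (x - 1))\<^sup>2)" for M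
    by (induction M) simp_all
  obtain u V where u: "U = add_mset u V" "u \<noteq> 1"
    using assms(2) by (meson multi_member_split)
  have "0 < (\<Sum>x\<in>#U. (cmod (x - 1))\<^sup>2)"
    using u nonneg[of V] by (simp add: add_pos_nonneg)
  then show ?thesis using expand[of U] assms(1) by simp
qed

section \<open>The chip-firing move and reachability\<close>

text \<open>Models the case \<open>I = n\<close>: because \<open>U\<close> sums to its own size,
  trading \<open>size U\<close> chips at \<open>v\<close> for \<open>scale v U\<close> keeps both
  the number of chips and their sum.\<close>

locale chip_firing =
  fixes U :: "complex multiset"
  assumes sum_U: "sum_mset U = of_nat (size U)" and nontrivial: "\<exists>u\<in>#U. u \<noteq> 1"
begin

inductive fire :: "complex multiset \<Rightarrow> complex multiset \<Rightarrow> bool" where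
  fireI: "fire (P + replicate_mset (size U) v) (P + scale v U)"

definition reach :: "complex multiset \<Rightarrow> complex multiset set" where
  "reach M = {M'. fire\<^sup>*\<^sup>* M M'}"

lemma U_nonempty [simp]: "U \<noteq> {#}"
  using nontrivial by auto

lemma reach_refl [simp]: "M \<in> reach M"
  by (simp add: reach_def)

lemma reach_step: "M' \<in> reach M \<Longrightarrow> fire M' M'' \<Longrightarrow> M'' \<in> reach M"
  by (simp add: reach_def)

lemma reach_trans: "M' \<in> reach M \<Longrightarrow> M'' \<in> reach M' \<Longrightarrow> M'' \<in> reach M"
  by (simp add: reach_def)

lemma reach_induct [consumes 1, case_names refl step]:
  assumes "M' \<in> reach M" and "P M"
    and "\<And>A B. A \<in> reach M \<Longrightarrow> P A \<Longrightarrow> fire A B \<Longrightarrow> P B"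
  shows "P M'"
proof -
  have "fire\<^sup>*\<^sup>* M M'" using assms(1) by (simp add: reach_def)
  then show ?thesis
    by (induction rule: rtranclp_induct) (use assms(2,3) in \<open>auto simp: reach_def\<close>)
qed

lemma fire_scale: "fire M M' \<Longrightarrow> fire (scale c M) (scale c M')"
  by (erule fire.cases) (use fireI[of "scale c _" "c * _"] in simp)

lemma fire_add: "fire A A' \<Longrightarrow> fire (A + B) (A' + B)"
proof (erule fire.cases)
  fix P v assume "A = P + replicate_mset (size U) v" "A' = P + scale v U"
  then show ?thesis using fireI[of "P + B" v] by (simp add: ac_simps)
qed

lemma fire_size: "fire M M' \<Longrightarrow> size M' = size M"
  by (erule fire.cases) simp

lemma fire_sum: "fire M M' \<Longrightarrow> sum_mset M' = sum_mset M"
  by (erule fire.cases) (simp add: sum_U)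

text \<open>The fired chips carry energy \<open>size U\<close> times |v|^2 before the move and
  \<open>energy U\<close> times |v|^2 after it. At v = 0 nothing would be gained, so chips at 0 are
  excluded.\<close>

lemma fire_energy:
  assumes "fire M M'" and "0 \<notin># M"
  shows "energy M < energy M'"
  using assms(1)
proof cases
  case (fireI P v)
  then have "v \<noteq> 0" using assms(2) by auto
  then show ?thesis
    using fireI energy_gt_size[OF sum_U nontrivial] by (simp add: mult.commute)
qed

lemma finite_fire: "finite {M'. fire M M'}"
proof (rule finite_subset)
  \<comment> \<open>The fired position determines the result, and it lies in \<open>M\<close>
    because \<open>U\<close> is nonempty.\<close>
  show "{M'. fire M M'} \<subseteq> (\<lambda>v. M - replicate_mset (size U) v + scale v U) ` set_mset M"
    by (auto elim!: fire.cases simp: image_iff)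
qed simp

lemma reach_scale_subset: "M' \<in> reach M \<Longrightarrow> scale c M' \<in> reach (scale c M)"
  by (induction rule: reach_induct) (auto intro: reach_step fire_scale)

lemma reach_scale:
  assumes "c \<noteq> 0"
  shows "reach (scale c M) = scale c ` reach M"
proof
  show "scale c ` reach M \<subseteq> reach (scale c M)"
    using reach_scale_subset by auto
  show "reach (scale c M) \<subseteq> scale c ` reach M"
  proof
    fix A assume "A \<in> reach (scale c M)"
    then have "scale (inverse c) A \<in> reach M"
      using reach_scale_subset[of A "scale c M" "inverse c"] assms by simp
    then show "A \<in> scale c ` reach M"
      using assms by (intro image_eqI[of _ _ "scale (inverse c) A"]) simp_all
  qed
qed

lemma reach_add: "A' \<in> reach A \<Longrightarrow> A' + B \<in> reach (A + B)"
  by (induction rule: reach_induct) (auto intro: reach_step fire_add)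

lemma reach_size: "M' \<in> reach M \<Longrightarrow> size M' = size M"
  by (induction rule: reach_induct) (auto simp: fire_size)

lemma reach_sum: "M' \<in> reach M \<Longrightarrow> sum_mset M' = sum_mset M"
  by (induction rule: reach_induct) (auto simp: fire_sum)

lemma reach_unfold: "reach M = insert M (\<Union>M'\<in>{M'. fire M M'}. reach M')"
  by (auto simp: reach_def elim: converse_rtranclpE intro: converse_rtranclp_into_rtranclp)

section \<open>Configurations without vanishing subsums\<close>

definition tame :: "complex multiset \<Rightarrow> bool" where
  "tame M \<longleftrightarrow> (\<forall>M'\<in>reach M. \<forall>A. A \<subseteq># M' \<longrightarrow> A \<noteq> {#} \<longrightarrow> sum_mset A \<noteq> 0)"

lemma tame_zero_notin: "tame M \<Longrightarrow> 0 \<notin># M"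
  unfolding tame_def by (metis mset_subset_eq_single add_mset_not_empty reach_refl sum_mset.singleton)

lemma tame_sum: "tame M \<Longrightarrow> M \<noteq> {#} \<Longrightarrow> sum_mset M \<noteq> 0"
  unfolding tame_def by (metis reach_refl subset_mset.order_refl)

lemma tame_reach: "tame M \<Longrightarrow> M' \<in> reach M \<Longrightarrow> tame M'"
  unfolding tame_def using reach_trans by blast

text \<open>The chips outside \<open>A\<close> can stay idle: whatever is reachable from
  \<open>A\<close> occurs as a part of something reachable from \<open>M\<close>.\<close>

lemma tame_subset:
  assumes "tame M" and "A \<subseteq># M"
  shows "tame A"
proof -
  obtain B where B: "M = A + B" using assms(2) by (metis mset_subset_eq_exists_conv)
  show ?thesis unfolding tame_def
  proof (intro ballI allI impI)
    fix A' C assume "A' \<in> reach A" "C \<subseteq># A'" "C \<noteq> {#}"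
    then have "A' + B \<in> reach M" "C \<subseteq># A' + B"
      using reach_add B by (auto intro: subset_mset.add_increasing2)
    then show "sum_mset C \<noteq> 0" using assms(1) \<open>C \<noteq> {#}\<close> by (auto simp: tame_def)
  qed
qed

lemma tame_scale:
  assumes "tame (scale c M)" and "c \<noteq> 0"
  shows "tame M"
  unfolding tame_def
proof (intro ballI allI impI)
  fix M' A assume "M' \<in> reach M" "A \<subseteq># M'" "A \<noteq> {#}"
  then have "scale c M' \<in> reach (scale c M)" "scale c A \<subseteq># scale c M'" "scale c A \<noteq> {#}"
    using reach_scale_subset scale_subseteq by auto
  then have "sum_mset (scale c A) \<noteq> 0" using assms(1) unfolding tame_def by blast
  then show "sum_mset A \<noteq> 0" by simp
qed

section \<open>Independent evolution of disjoint clusters\<close>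

text \<open>Disjoint supports put all chips at the fired position \<open>v\<close> into one cluster,
  which therefore has enough of them to fire alone.\<close>

lemma fire_sum_disjoint:
  assumes "finite J" and disj: "\<And>i j. i \<in> J \<Longrightarrow> j \<in> J \<Longrightarrow> i \<noteq> j \<Longrightarrow> set_mset (A i) \<inter> set_mset (A j) = {}"
    and "fire (\<Sum>j\<in>J. A j) M'"
  shows "\<exists>i\<in>J. \<exists>B. fire (A i) B \<and> M' = (\<Sum>j\<in>J. (A(i := B)) j)"
  using assms(3)
proof cases
  case (fireI P v)
  have "v \<in># (\<Sum>j\<in>J. A j)" using fireI by simp
  then obtain i where i: "i \<in> J" "v \<in># A i"
    using assms(1) by (auto simp: set_mset_sum)
  have "count (\<Sum>j\<in>J. A j) v = (\<Sum>j\<in>J. count (A j) v)"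
    by (simp add: count_sum)
  also have "\<dots> = (\<Sum>j\<in>{i}. count (A j) v)"
    by (rule sum.mono_neutral_right) (use assms(1) i disj[of i] in \<open>auto simp: not_in_iff[symmetric]\<close>)
  finally have "size U \<le> count (A i) v" using fireI by simp
  then obtain Q where Q: "A i = Q + replicate_mset (size U) v"
    by (metis count_le_replicate_mset_subset_eq subset_mset.diff_add)
  have J: "(\<Sum>j\<in>J. B j) = B i + (\<Sum>j\<in>J - {i}. B j)" for B :: "'a \<Rightarrow> complex multiset"
    using assms(1) i by (simp add: sum.remove)
  have "P = Q + (\<Sum>j\<in>J - {i}. A j)" using fireI J[of A] Q by simp
  then have "M' = (\<Sum>j\<in>J. (A(i := Q + scale v U)) j)"
    using fireI J[of "A(i := Q + scale v U)"] by (simp add: ac_simps)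
  moreover have "fire (A i) (Q + scale v U)"
    unfolding Q by (rule fire.intros)
  ultimately show ?thesis using i by blast
qed

text \<open>\<open>W j\<close> bounds every position that cluster \<open>j\<close> can occupy when
  evolving alone. As these bounds are disjoint, the current clusters stay disjoint and each further
  move again belongs to a single cluster.\<close>

lemma reach_sum_disjoint:
  assumes "finite J" and disj: "\<And>i j. i \<in> J \<Longrightarrow> j \<in> J \<Longrightarrow> i \<noteq> j \<Longrightarrow> W i \<inter> W j = {}"
    and W: "\<And>j B. j \<in> J \<Longrightarrow> B \<in> reach (A j) \<Longrightarrow> set_mset B \<subseteq> W j"
    and "M' \<in> reach (\<Sum>j\<in>J. A j)"
  shows "\<exists>A'. (\<forall>j\<in>J. A' j \<in> reach (A j)) \<and> M' = (\<Sum>j\<in>J. A' j)"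
  using assms(4)
proof (induction rule: reach_induct)
  case refl
  show ?case by (rule exI[of _ A]) simp
next
  case (step M B)
  then obtain A' where A': "\<forall>j\<in>J. A' j \<in> reach (A j)" "M = (\<Sum>j\<in>J. A' j)" by blast
  have "\<exists>i\<in>J. \<exists>C. fire (A' i) C \<and> B = (\<Sum>j\<in>J. (A'(i := C)) j)"
  proof (rule fire_sum_disjoint[OF assms(1)])
    show "set_mset (A' i) \<inter> set_mset (A' j) = {}" if "i \<in> J" "j \<in> J" "i \<noteq> j" for i j
      using that disj W A'(1) by blast
    show "fire (\<Sum>j\<in>J. A' j) B" using step.hyps(2) A'(2) by simp
  qed
  then obtain i C where iC: "i \<in> J" "fire (A' i) C" "B = (\<Sum>j\<in>J. (A'(i := C)) j)" by blast
  have "\<forall>j\<in>J. (A'(i := C)) j \<in> reach (A j)"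
    using A'(1) iC reach_step by auto
  then show ?case using iC(3) by blast
qed

lemma finite_reach_sum_disjoint:
  assumes "finite J" and "\<And>i j. i \<in> J \<Longrightarrow> j \<in> J \<Longrightarrow> i \<noteq> j \<Longrightarrow> W i \<inter> W j = {}"
    and "\<And>j B. j \<in> J \<Longrightarrow> B \<in> reach (A j) \<Longrightarrow> set_mset B \<subseteq> W j"
    and fin: "\<And>j. j \<in> J \<Longrightarrow> finite (reach (A j))"
  shows "finite (reach (\<Sum>j\<in>J. A j))"
proof (rule finite_subset)
  show "finite ((\<lambda>B. \<Sum>j\<in>J. B j) ` (\<Pi>\<^sub>E j\<in>J. reach (A j)))"
    using assms(1) fin by (intro finite_imageI finite_PiE)
  show "reach (\<Sum>j\<in>J. A j) \<subseteq> (\<lambda>B. \<Sum>j\<in>J. B j) ` (\<Pi>\<^sub>E j\<in>J. reach (A j))"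
  proof
    fix M' assume "M' \<in> reach (\<Sum>j\<in>J. A j)"
    from reach_sum_disjoint[of J W A, OF assms(1-3) this] obtain A' where
      A': "\<forall>j\<in>J. A' j \<in> reach (A j)" "M' = (\<Sum>j\<in>J. A' j)" by blast
    then show "M' \<in> (\<lambda>B. \<Sum>j\<in>J. B j) ` (\<Pi>\<^sub>E j\<in>J. reach (A j))"
      by (intro image_eqI[of _ _ "restrict A' J"]) auto
  qed
qed

section \<open>Nonterminating configurations and their shapes up to scaling\<close>

definition bad :: "complex multiset \<Rightarrow> bool" where
  "bad M \<longleftrightarrow> tame M \<and> infinite (reach M)"

text \<open>The step of Koenig's lemma: there are only finitely many successors, so if each had a
  finite reach, \<open>M\<close> would have one too.\<close>

lemma bad_fire:
  assumes "bad M"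
  shows "\<exists>M'. fire M M' \<and> bad M'"
proof (rule ccontr)
  assume none: "\<not> ?thesis"
  have "finite (reach M')" if "fire M M'" for M'
    using none that assms tame_reach[OF _ reach_step[OF reach_refl that]] by (auto simp: bad_def)
  then have "finite (reach M)"
    by (subst reach_unfold) (use finite_fire in auto)
  then show False using assms by (simp add: bad_def)
qed

text \<open>Clusters whose ratio avoids a finite set never interact, so a bad configuration
  made of at least two clusters has two clusters at one of finitely many relative positions; these are merged.\<close>

lemma bad_finitely_many_shapes:
  assumes smaller: "\<And>M. tame M \<Longrightarrow> size M < N \<Longrightarrow> finite (reach M)"
    and "finite J" "J \<noteq> {}" "\<forall>j\<in>J. S j \<noteq> {#}" "(\<Sum>j\<in>J. size (S j)) = N"
  shows "\<exists>T. finite T \<and> (\<forall>x. (\<forall>j\<in>J. x j \<noteq> 0) \<longrightarrow> bad (\<Sum>j\<in>J. scale (x j) (S j)) \<longrightarrow>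
           (\<exists>M\<in>T. \<exists>c. (\<Sum>j\<in>J. scale (x j) (S j)) = scale c M))"
  using assms(2-5)
\<comment> \<open>The induction is on the number of clusters; merging two of them lowers it and
  keeps the total \<open>N\<close>.\<close>
proof (induction "card J" arbitrary: J S rule: less_induct)
  case less
  show ?case
  proof (cases "card J = 1")
    case True
    then obtain j where "J = {j}" by (auto simp: card_1_singleton_iff)
    then show ?thesis by (intro exI[of _ "{S j}"]) auto
  next
    case False
    show ?thesis
    proof (cases "\<forall>j\<in>J. tame (S j)")
      case False
      then obtain j where j: "j \<in> J" "\<not> tame (S j)" by blast
      \<comment> \<open>A scaled copy of a cluster that is not tame spoils the tameness of the
        whole, so there is no shape to list.\<close>
      have "\<not> bad (\<Sum>j\<in>J. scale (x j) (S j))" if "\<forall>j\<in>J. x j \<noteq> 0" for x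
      proof
        assume "bad (\<Sum>j\<in>J. scale (x j) (S j))"
        moreover have "(\<Sum>j\<in>J. scale (x j) (S j)) = scale (x j) (S j) + (\<Sum>j\<in>J - {j}. scale (x j) (S j))"
          using less.prems(1) j(1) by (simp add: sum.remove)
        ultimately have "tame (scale (x j) (S j))"
          unfolding bad_def by (metis mset_subset_eq_add_left tame_subset)
        then show False using tame_scale that j by blast
      qed
      then show ?thesis by (intro exI[of _ "{}"]) auto
    next
      case tame: True
      \<comment> \<open>Another nonempty cluster takes up some of the \<open>N\<close> chips, so
        \<open>smaller\<close> applies to each single cluster.\<close>
      have small: "size (S i) < N" if "i \<in> J" for i
      proof -
        have "card J > 1" using False less.prems(1,2) by (metis card_0_eq less_one linorder_neqE_nat)
        then obtain j where j: "j \<in> J" "j \<noteq> i"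
          using less.prems(1) by (metis card_le_Suc0_iff_eq not_le One_nat_def)
        have "size (S i) + size (S j) = (\<Sum>k\<in>{i, j}. size (S k))" using j by simp
        also have "\<dots> \<le> N"
          unfolding less.prems(4)[symmetric] by (rule sum_mono2) (use less.prems(1) that j in auto)
        finally show ?thesis using less.prems(3) j by (metis add_less_same_cancel1 le_neq_implies_less
              less_add_same_cancel1 nonempty_has_size order.strict_trans2)
      qed
      \<comment> \<open>All positions that the unscaled cluster \<open>j\<close> can ever occupy.
        Scaling by \<open>x j\<close> multiplies them by \<open>x j\<close>.\<close>
      define W where "W j = (\<Union>B\<in>reach (S j). set_mset B)" for j
      have W: "finite (W j)" "0 \<notin> W j" if "j \<in> J" for j
        using smaller small tame that tame_reach tame_zero_notin by (auto simp: W_def)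
      \<comment> \<open>Clusters \<open>i\<close> and \<open>j\<close> can touch only if
        \<open>x i * w = x j * w'\<close> for positions \<open>w\<close> and \<open>w'\<close> of
        theirs, that is, if \<open>x i = x j * q\<close> with \<open>q = w' / w\<close>. Finiteness
        of \<open>W\<close> leaves finitely many such \<open>q\<close>.\<close>
      define Q where "Q = (\<lambda>(i, j). (\<lambda>(w, w'). w' / w) ` (W i \<times> W j))"
      define I where "I = (SIGMA p:{p \<in> J \<times> J. fst p \<noteq> snd p}. Q p)"
      have "finite I"
        unfolding I_def using less.prems(1) W by (intro finite_SigmaI) (auto simp: Q_def)
      define P where "P = (\<lambda>((i, j), q) T. finite T \<and> (\<forall>x. (\<forall>k\<in>J. x k \<noteq> 0) \<longrightarrow> x i = x j * q \<longrightarrow>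
         bad (\<Sum>k\<in>J. scale (x k) (S k)) \<longrightarrow> (\<exists>M\<in>T. \<exists>c. (\<Sum>k\<in>J. scale (x k) (S k)) = scale c M)))"
      have "\<exists>T. P t T" if tI: "t \<in> I" for t
      proof -
        obtain i j q where t: "t = ((i, j), q)" "i \<in> J" "j \<in> J" "i \<noteq> j"
          using tI by (cases t) (auto simp: I_def)
        define S' where "S' = S(j := S j + scale q (S i))"
        have split: "(\<Sum>k\<in>J. f k) = f i + (f j + (\<Sum>k\<in>J - {i} - {j}. f k))"
          and split': "(\<Sum>k\<in>J - {i}. f k) = f j + (\<Sum>k\<in>J - {i} - {j}. f k)"
          for f :: "_ \<Rightarrow> 'b :: comm_monoid_add"
          using t less.prems(1) sum.remove[of J i f] sum.remove[of "J - {i}" j f] by simp_all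
        have merge: "(\<Sum>k\<in>J. scale (x k) (S k)) = (\<Sum>k\<in>J - {i}. scale (x k) (S' k))"
          if "x i = x j * q" for x
          using that unfolding split split' by (simp add: S'_def ac_simps)
        have "(\<Sum>k\<in>J - {i}. size (S' k)) = N"
          using less.prems(4) unfolding split split' by (simp add: S'_def ac_simps)
        moreover have "\<forall>k\<in>J - {i}. S' k \<noteq> {#}" using less.prems(3) by (simp add: S'_def)
        moreover have "card (J - {i}) < card J" using t less.prems(1) by (intro card_Diff1_less)
        moreover have "J - {i} \<noteq> {}" using t by blast
        ultimately obtain T where "finite T" "\<forall>x. (\<forall>k\<in>J - {i}. x k \<noteq> 0) \<longrightarrow>
            bad (\<Sum>k\<in>J - {i}. scale (x k) (S' k)) \<longrightarrow>
            (\<exists>M\<in>T. \<exists>c. (\<Sum>k\<in>J - {i}. scale (x k) (S' k)) = scale c M)"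
          using less.hyps[of "J - {i}" S'] less.prems(1) by auto
        then show ?thesis by (intro exI[of _ T]) (auto simp: t P_def merge)
      qed
      then obtain G where G: "\<And>t. t \<in> I \<Longrightarrow> P t (G t)" by metis
      show ?thesis
      proof (intro exI[of _ "\<Union>t\<in>I. G t"] conjI allI impI)
        show "finite (\<Union>t\<in>I. G t)"
          using \<open>finite I\<close> G by (force simp: P_def split: prod.splits)
        fix x assume x: "\<forall>j\<in>J. x j \<noteq> 0" and bad: "bad (\<Sum>j\<in>J. scale (x j) (S j))"
        \<comment> \<open>If no two clusters could touch, each would evolve alone and has a finite
          reach, so the whole could not be bad.\<close>
        have "\<exists>i\<in>J. \<exists>j\<in>J. i \<noteq> j \<and> (*) (x i) ` W i \<inter> (*) (x j) ` W j \<noteq> {}"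
        proof (rule ccontr)
          assume "\<not> ?thesis"
          then have "finite (reach (\<Sum>j\<in>J. scale (x j) (S j)))"
          proof (intro finite_reach_sum_disjoint[where W = "\<lambda>j. (*) (x j) ` W j"])
            show "set_mset B \<subseteq> (*) (x j) ` W j" if "j \<in> J" "B \<in> reach (scale (x j) (S j))" for j B
              using that x by (fastforce simp: reach_scale W_def)
            show "finite (reach (scale (x j) (S j)))" if "j \<in> J" for j
              using that smaller small tame x by (simp add: reach_scale)
          qed (use less.prems(1) in blast)+
          then show False using bad by (simp add: bad_def)
        qed
        then obtain i j w w' where ij: "i \<in> J" "j \<in> J" "i \<noteq> j" "w \<in> W i" "w' \<in> W j" "x i * w = x j * w'"
          by blast
        have "w \<noteq> 0" using W(2)[OF ij(1)] ij(4) by blast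
        then have "x i = x j * (w' / w)" using ij(6) by (simp add: field_simps)
        moreover have "((i, j), w' / w) \<in> I" using ij by (force simp: I_def Q_def)
        ultimately show "\<exists>M\<in>\<Union>t\<in>I. G t. \<exists>c. (\<Sum>j\<in>J. scale (x j) (S j)) = scale c M"
          using G[of "((i, j), w' / w)"] x bad unfolding P_def by fastforce
      qed
    qed
  qed
qed

section \<open>Termination of chip firing\<close>

lemma tame_finite_reach: "tame M \<Longrightarrow> finite (reach M)"
proof (induction "size M" arbitrary: M rule: less_induct)
  case less
  show ?case
  proof (rule ccontr)
    assume "infinite (reach M)"
    then have "bad M" using less.prems by (simp add: bad_def)
    have nonempty: "M \<noteq> {#}"
      using bad_fire[OF \<open>bad M\<close>] by (auto elim!: fire.cases)
    \<comment> \<open>Initially every chip is a cluster of its own: the chip 1 scaled to its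
      position \<open>x j\<close>.\<close>
    obtain T where "finite T" and T: "\<And>x. (\<forall>j<size M. x j \<noteq> 0) \<Longrightarrow>
        bad (\<Sum>j<size M. scale (x j) {#1#}) \<Longrightarrow>
        \<exists>A\<in>T. \<exists>c. (\<Sum>j<size M. scale (x j) {#1#}) = scale c A"
      using bad_finitely_many_shapes[of "size M" "{..<size M}" "\<lambda>_. {#1#}"] less.hyps nonempty
      by (auto simp: lessThan_empty_iff)
    have shape: "\<exists>A\<in>T. \<exists>c. B = scale c A" if "bad B" "size B = size M" for B
    proof -
      obtain xs where xs: "B = mset xs" by (metis ex_mset)
      have "0 \<notin> set xs" using that(1) xs tame_zero_notin[of B] by (auto simp: bad_def)
      then have "\<forall>j<size M. xs ! j \<noteq> 0" using that(2) xs by (metis nth_mem size_mset)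
      moreover have "B = (\<Sum>j<size M. scale (xs ! j) {#1#})"
        using that(2) mset_eq_sum_singletons[of xs] xs by (simp add: scale_def)
      ultimately show ?thesis using T[of "\<lambda>j. xs ! j"] that(1) by auto
    qed
    obtain f where f: "\<And>k. bad (f k) \<and> f k \<in> reach M" "\<And>k. fire (f k) (f (Suc k))"
      using dependent_nat_choice[of "\<lambda>_ B. bad B \<and> B \<in> reach M" "\<lambda>_. fire"]
        \<open>bad M\<close> bad_fire reach_step reach_refl by metis
    have "\<exists>A\<in>T. \<exists>c. f k = scale c A" for k
      using shape f(1) reach_size by blast
    then obtain A c where Ac: "\<And>k. A k \<in> T" "\<And>k. f k = scale (c k) (A k)" by metis
    have "energy (f k) < energy (f (Suc k))" for k
      using fire_energy f tame_zero_notin by (auto simp: bad_def)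
    then have "inj (energy \<circ> f)"
      by (intro strict_mono_imp_inj_on) (simp add: strict_mono_Suc_iff)
    \<comment> \<open>Pigeonhole: the infinite run visits only the finitely many shapes in
      \<open>T\<close>.\<close>
    have "\<not> inj A"
      using \<open>finite T\<close> Ac(1) by (metis finite_imageD finite_subset image_subsetI infinite_UNIV_nat)
    then obtain k l where kl: "k \<noteq> l" "A k = A l" by (auto simp: inj_def)
    have "sum_mset (f k) = sum_mset (f l)" "sum_mset (f k) \<noteq> 0"
      using f(1) reach_sum tame_sum[OF less.prems nonempty] by metis+
    \<comment> \<open>The equal nonzero sums are \<open>c k\<close> and \<open>c l\<close> times the
      sum of the common shape, which can be cancelled.\<close>
    then have "c k = c l" using kl Ac(2)[of k] Ac(2)[of l] by auto
    then have "f k = f l" using kl Ac(2) by simp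
    then show False using injD[OF \<open>inj (energy \<circ> f)\<close>, of k l] kl(1) by simp
  qed
qed

text \<open>A reachable configuration of maximal energy exists because the reach is finite, and it
  cannot fire because firing would raise the energy.\<close>

lemma tame_stabilizes:
  assumes "tame M"
  shows "\<exists>M'\<in>reach M. \<forall>v. count M' v < size U"
proof -
  have fin: "finite (energy ` reach M)" "energy ` reach M \<noteq> {}"
    using tame_finite_reach[OF assms] reach_refl by blast+
  obtain M' where M': "M' \<in> reach M" "energy M' = Max (energy ` reach M)"
    using Max_in[OF fin] by (metis imageE)
  have "count M' v < size U" for v
  proof (rule ccontr)
    assume "\<not> ?thesis"
    then have "M' = M' - replicate_mset (size U) v + replicate_mset (size U) v"
      by (metis count_le_replicate_mset_subset_eq not_le subset_mset.diff_add)
    then obtain M'' where fire: "fire M' M''" using fireI by metis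
    then have "M'' \<in> reach M" using M'(1) reach_step by blast
    then have "energy M'' \<le> energy M'" using M'(2) fin by simp
    moreover have "energy M' < energy M''"
      using fire fire_energy tame_zero_notin tame_reach[OF assms M'(1)] by blast
    ultimately show False by simp
  qed
  then show ?thesis using M'(1) by blast
qed

end

section \<open>Representations as multisets, with multiplicities as coefficients\<close>

lemma sum_mset_sum: "sum_mset (\<Sum>i\<in>A. f i) = (\<Sum>i\<in>A. sum_mset (f i))"
  by (induction A rule: infinite_finite_induct) simp_all

text \<open>A negative coefficient of \<open>e\<close> is turned into a positive multiplicity of
  \<open>- e\<close>; at most one of \<open>nat (c e)\<close> and \<open>nat (- c e)\<close> is
  nonzero.\<close>

lemma int_span_mset:
  assumes "finite E" and "\<And>e. e \<in> E \<Longrightarrow> e \<in> G \<and> - e \<in> G" and "\<alpha> \<in> int_span E"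
  shows "\<exists>M. set_mset M \<subseteq> G \<and> sum_mset M = (\<alpha> :: complex)"
proof -
  obtain c where c: "\<alpha> = (\<Sum>e\<in>E. of_int (c e) * e)" using assms(3) by (auto simp: int_span_def)
  define M where "M = (\<Sum>e\<in>E. replicate_mset (nat (c e)) e + replicate_mset (nat (- c e)) (- e))"
  have "set_mset M \<subseteq> G"
    using assms(1,2) by (auto simp: M_def set_mset_sum split: if_splits)
  moreover have "sum_mset M = \<alpha>"
  proof -
    have "sum_mset M = (\<Sum>e\<in>E. sum_mset (replicate_mset (nat (c e)) e + replicate_mset (nat (- c e)) (- e)))"
      unfolding M_def by (rule sum_mset_sum)
    also have "\<dots> = \<alpha>" unfolding c
    proof (rule sum.cong[OF refl])
      fix e
      have "(of_int (c e) :: complex) = of_nat (nat (c e)) - of_nat (nat (- c e))"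
        by (cases "c e \<ge> 0") simp_all
      then show "sum_mset (replicate_mset (nat (c e)) e + replicate_mset (nat (- c e)) (- e)) = of_int (c e) * e"
        by (simp add: left_diff_distrib)
    qed
    finally show ?thesis .
  qed
  ultimately show ?thesis by blast
qed

lemma bounded_representation:
  fixes u :: "nat \<Rightarrow> complex"
  assumes mult: "\<And>x y. x \<in> G \<Longrightarrow> y \<in> G \<Longrightarrow> x * y \<in> G"
    and "I \<le> n" and uG: "\<forall>i<I. u i \<in> G" and sum: "(\<Sum>i<I. u i) = of_nat n" and "\<exists>i<I. u i \<noteq> 1"
    and ex: "\<exists>M. set_mset M \<subseteq> G \<and> sum_mset M = \<alpha>"
  shows "\<exists>M. set_mset M \<subseteq> G \<and> sum_mset M = \<alpha> \<and> (\<forall>v. count M v < n)"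
proof -
  define rep where "rep M \<longleftrightarrow> set_mset M \<subseteq> G \<and> sum_mset M = \<alpha>" for M
  obtain M where M: "rep M" and min: "\<And>A. rep A \<Longrightarrow> size M \<le> size A"
    using ex ex_has_least_nat[of rep _ size] unfolding rep_def by metis
  define U where "U = image_mset u (mset_set {..<I})"
  have U: "size U = I" "set_mset U = u ` {..<I}" "sum_mset U = of_nat n"
    using sum by (simp_all add: U_def sum_unfold_sum_mset)
  show ?thesis
  proof (cases "I = n")
    case False
    have "count M v < n" for v
    proof (rule ccontr)
      assume "\<not> ?thesis"
      then obtain P where P: "M = P + replicate_mset n v"
        by (metis count_le_replicate_mset_subset_eq not_le subset_mset.diff_add)
      \<comment> \<open>This ensures that \<open>v\<close> really occurs in \<open>M\<close>, so
        that \<open>v\<close> and the products with it lie in \<open>G\<close>.\<close>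
      moreover have "n \<noteq> 0" using False \<open>I \<le> n\<close> by simp
      ultimately have "rep (P + scale v U)"
        using M U uG mult by (auto simp: rep_def)
      from min[OF this] show False using P U False \<open>I \<le> n\<close> by simp
    qed
    then show ?thesis using M by (auto simp: rep_def)
  next
    case True
    interpret chip_firing U
      by unfold_locales (use U True assms(5) in auto)
    have rep: "rep A" if "A \<in> reach M" for A
      using that
    proof (induction rule: reach_induct)
      case (step A B)
      from step.hyps(2) obtain P v where
        AB: "A = P + replicate_mset (size U) v" "B = P + scale v U" by (rule fire.cases)
      then have "set_mset P \<subseteq> G" "v \<in> G" using step.IH by (auto simp: rep_def)
      then have "set_mset B \<subseteq> G" using AB U uG mult by auto
      then show ?case using step fire_sum by (auto simp: rep_def)
    qed (rule M)
    \<comment> \<open>Deleting a vanishing subsum from a reachable configuration would leave a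
      representation of \<alpha> with fewer terms than \<open>M\<close>, since firing keeps the
      size.\<close>
    have "tame M" unfolding tame_def
    proof (intro ballI allI impI notI)
      fix A B assume AB: "A \<in> reach M" "B \<subseteq># A" "B \<noteq> {#}" "sum_mset B = 0"
      obtain C where C: "A = B + C" using AB(2) by (metis mset_subset_eq_exists_conv)
      then have "rep C" using rep[OF AB(1)] AB(4) by (auto simp: rep_def)
      from min[OF this] show False using reach_size[OF AB(1)] C AB(3) by (simp add: nonempty_has_size)
    qed
    then show ?thesis using tame_stabilizes rep U True by (metis rep_def)
  qed
qed

section \<open>From multisets to unit sum heights\<close>

text \<open>The support of \<open>M\<close> with its multiplicities is the required representation;
  the nonzero sum makes the support nonempty, so that the maximum is meaningful.\<close>

lemma rep_heights_bound:
  assumes "set_mset M \<subseteq> \<Gamma> \<inter> R" and "\<And>v. count M v < n" and "sum_mset M \<noteq> 0"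
  shows "\<exists>h\<in>rep_heights R \<Gamma> (sum_mset M). h \<le> n - 1"
proof
  have ne: "set_mset M \<noteq> {}" using assms(3) by auto
  have "M = (\<Sum>v\<in>set_mset M. replicate_mset (count M v) v)"
    by (rule multiset_eqI) (simp add: count_sum count_eq_zero_iff)
  from arg_cong[OF this, of sum_mset]
  have sum: "sum_mset M = (\<Sum>v\<in>set_mset M. of_nat (count M v) * v)"
    by (simp only: sum_mset_sum sum_mset_replicate_mset)
  show "Max (count M ` set_mset M) \<in> rep_heights R \<Gamma> (sum_mset M)"
    unfolding rep_heights_def
    by (intro CollectI exI[of _ "set_mset M"] exI[of _ "count M"] conjI refl sum ne assms(1))
       simp_all
  have "count M v \<le> n - 1" for v using assms(2)[of v] by simp
  then show "Max (count M ` set_mset M) \<le> n - 1" using ne by simp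
qed

text \<open>The heights form a nonempty bounded set of naturals, so their maximum is attained. This
  selects the first branch of \<open>ush_ring\<close>, and antisymmetry makes the value described
  there unique.\<close>

lemma ush_ring_bound:
  assumes "R \<noteq> {}" and "\<And>\<alpha>. \<alpha> \<in> R \<Longrightarrow> ush_height R \<Gamma> \<alpha> \<le> enat k"
  shows "\<exists>m. ush_ring \<Gamma> R = Fin m \<and> m \<le> k"
proof -
  let ?P = "\<lambda>m. (\<exists>\<alpha>\<in>R. ush_height R \<Gamma> \<alpha> = enat m) \<and> (\<forall>\<alpha>\<in>R. ush_height R \<Gamma> \<alpha> \<le> enat m)"
  define H where "H = {h. \<exists>\<alpha>\<in>R. ush_height R \<Gamma> \<alpha> = enat h}"
  have bound: "h \<le> k" if "h \<in> H" for h
    using that assms(2) by (fastforce simp: H_def)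
  have fin: "finite H" using bound by (meson finite_nat_set_iff_bounded_le)
  have height: "\<exists>h\<in>H. ush_height R \<Gamma> \<alpha> = enat h" if "\<alpha> \<in> R" for \<alpha>
    using assms(2)[OF that] that enat_ile by (fastforce simp: H_def)
  have "H \<noteq> {}" using assms(1) height by blast
  then have "Max H \<in> H" using fin by simp
  have P: "?P (Max H)"
  proof
    show "\<exists>\<alpha>\<in>R. ush_height R \<Gamma> \<alpha> = enat (Max H)" using \<open>Max H \<in> H\<close> by (simp add: H_def)
    show "\<forall>\<alpha>\<in>R. ush_height R \<Gamma> \<alpha> \<le> enat (Max H)" using height fin by fastforce
  qed
  have "(THE m. ?P m) = Max H"
    by (rule the_equality[of ?P, OF P]) (metis P antisym enat_ord_simps(1))
  moreover have "\<exists>m. ?P m" using P by blast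
  ultimately have "ush_ring \<Gamma> R = Fin (Max H)" unfolding ush_ring_def by (simp only: if_True)
  then show ?thesis using bound[OF \<open>Max H \<in> H\<close>] by blast
qed

theorem theorem1:
  fixes F \<Gamma> R E :: "complex set" and n I :: nat and u :: "nat \<Rightarrow> complex"
  assumes "subfield_C F"
    and "fin_gen_mult_subgroup F \<Gamma>"
    and "-1 \<in> \<Gamma>"
    and "subring_of F R"
    and "finite E" and "E \<subseteq> \<Gamma> \<inter> R" and "R = int_span E"
    and "2 \<le> I" and "I \<le> n"
    and "\<forall>i<I. u i \<in> \<Gamma> \<inter> R" and "(\<Sum>i<I. u i) = of_nat n"
    and "\<exists>i<I. u i \<noteq> 1"
  shows "\<exists>m. ush_ring \<Gamma> R = Fin m \<and> m \<le> n - 1"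
proof (rule ush_ring_bound)
  show "R \<noteq> {}" using assms(4) by (auto simp: subring_of_def)
  have mult\<Gamma>: "x * y \<in> \<Gamma>" if "x \<in> \<Gamma>" "y \<in> \<Gamma>" for x y
    using assms(2) that by (auto simp: fin_gen_mult_subgroup_def mult_subgroup_def)
  have mult: "x * y \<in> \<Gamma> \<inter> R" if "x \<in> \<Gamma> \<inter> R" "y \<in> \<Gamma> \<inter> R" for x y
    using that mult\<Gamma> assms(4) by (auto simp: subring_of_def)
  \<comment> \<open>In \<Gamma> the element \<open>- e\<close> is the product of -1 and
    \<open>e\<close>; this provides the negatives needed for integer coefficients.\<close>
  have neg: "e \<in> \<Gamma> \<inter> R \<and> - e \<in> \<Gamma> \<inter> R" if "e \<in> E" for e
    using that assms(4,6) mult\<Gamma>[OF assms(3), of e] by (auto simp: subring_of_def)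
  fix \<alpha> assume "\<alpha> \<in> R"
  show "ush_height R \<Gamma> \<alpha> \<le> enat (n - 1)"
  proof (cases "\<alpha> = 0")
    case False
    have "\<exists>M. set_mset M \<subseteq> \<Gamma> \<inter> R \<and> sum_mset M = \<alpha>"
      using int_span_mset[OF assms(5) neg] \<open>\<alpha> \<in> R\<close> assms(7) by blast
    from bounded_representation[OF mult assms(9-12) this] obtain M where
      "set_mset M \<subseteq> \<Gamma> \<inter> R" "sum_mset M = \<alpha>" "\<And>v. count M v < n" by blast
    with rep_heights_bound[of M \<Gamma> R n] False obtain h where
      h: "h \<in> rep_heights R \<Gamma> \<alpha>" "h \<le> n - 1" by blast
    have "ush_height R \<Gamma> \<alpha> \<le> enat h"
      using h(1) False by (auto simp: ush_height_def intro: Inf_lower)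
    also have "\<dots> \<le> enat (n - 1)" using h(2) by simp
    finally show ?thesis .
  qed (simp add: ush_height_def)
qed

end
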